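(* Let $f\in\mathbb F$. For $i=1,2$, let $X_i$ be a random variable taking values in a measurable space $(\Omega_i,\mathcal F_i)$ (with $X_1,X_2$ defined on a common probability space) and let $\varphi_i$ be a measurable function from $(\Omega_i,\mathcal F_i)$ to a measurable space $(E_i,\mathcal E_i)$. (i) (Marginal invariance) If $\dfrac{d(P_{X_1}\otimes P_{X_2})}{dP_{(X_1,X_2)}}$ is $\sigma(\varphi_1)\otimes\sigma(\varphi_2)$-measurable (i.e. admits such a version), then $$S_f(X_1,X_2)=S_f(\varphi_1(X_1),\varphi_2(X_2)).$$ (ii) (Invariance by injection) If, for $i=1,2$, the function $\varphi_i$ is injective and bi-measurable, then $$S_f(X_1,X_2)=S_f(\varphi_1(X_1),\varphi_2(X_2)).$$ (iii) (Invariance for independent Markovian kernels) Assume that for $i=1,2$ the random variable $X_i$ can be written as $X_i=(Y_i,W_i)$ and takes values in a (product) Polish space, so that the following conditional distributions exist. If $$P_{(W_1,W_2)|(Y_1,Y_2)=(y_1,y_2)}(dw_1,dw_2)=\prod_{i=1}^2P_{W_i|Y_i=y_i}(dw_i)$$ holds $P_{(Y_1,Y_2)}(dy_1,dy_2)$-a.s., then $$S_f\big((Y_1,W_1),(Y_2,W_2)\big)=S_f(Y_1,Y_2).$$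
   Context: A proper convex function on $\mathbb R$ is a convex function with values in $(-\infty,+\infty]$ finite at some point; $\mathrm{dom}(f)=f^{-1}(\mathbb R)$. $\mathbb F$ is the set of proper convex functions $f$ on $\mathbb R$ with $\mathrm{dom}(f)\subset[0,\infty)$, right continuous at $0$ (i.e. $f(0)=\lim_{t\to0+}f(t)\in(-\infty,+\infty]$), $f(1)=0$, and $1$ in the interior of $\mathrm{dom}(f)$. For $f\in\mathbb F$, $f^*(0):=\lim_{t\to+\infty}f(t)/t$. For probability measures $P,Q$ on the same measurable space, not assumed absolutely continuous with respect to each other, with densities $p,q$ w.r.t. a dominating $\sigma$-finite measure, $\frac{dP}{dQ}:=p/q\in[0,+\infty]$ (convention $0/0=0$), defined $(P+Q)$-a.e., and $$D_f(P\Vert Q)=\int f\left(\frac{dP}{dQ}\right)dQ+f^*(0)\,P\left(\frac{dP}{dQ}=+\infty\right),$$ the last term being $0$ by convention if $P\ll Q$. The Csiszár index is $S_f(X,Y)=D_f(P_X\otimes P_Y\,\Vert\,P_{(X,Y)})$, with $P_Z$ the distribution of $Z$; it may be infinite. $\sigma(\varphi)=\{\varphi^{-1}(A):A\in\mathcal E\}$ for $\varphi:\Omega\to(E,\mathcal E)$. A function $\varphi:(\Omega,\mathcal F)\to(E,\mathcal E)$ is bi-measurable if $\varphi(A)\in\mathcal E$ for all $A\in\mathcal F$. $P_{W|Y=y}(dw)$ denotes the (regular) conditional distribution of $W$ given $Y$, a Markov kernel with $P_{(Y,W)}(dy,dw)=P_Y(dy)P_{W|Y=y}(dw)$. *)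

theory Defs
  imports "HOL-Probability.Probability"
begin

section \<open>The class of admissible functions\<close>

text \<open>Extended-valued functions on the real line are modelled as \<^typ>\<open>real \<Rightarrow> ereal\<close>.
  As \<open>-\<infinity>\<close> is excluded, the right-hand side of the convexity inequality is never
  of the form \<open>\<infinity> - \<infinity>\<close>; for \<open>t = 0\<close> and \<open>t = 1\<close> it is trivial because \<open>0 * \<infinity> = 0\<close>
  in \<^typ>\<open>ereal\<close>.\<close>

definition proper_convex :: "(real \<Rightarrow> ereal) \<Rightarrow> bool" where
  "proper_convex f \<longleftrightarrow>
     (\<forall>x. f x \<noteq> -\<infinity>) \<and> (\<exists>x. f x \<noteq> \<infinity>) \<and>
     (\<forall>x y. \<forall>t\<in>{0..1}. f ((1 - t) * x + t * y) \<le> ereal (1 - t) * f x + ereal t * f y)"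

definition edom :: "(real \<Rightarrow> ereal) \<Rightarrow> real set" where
  "edom f = {x. \<bar>f x\<bar> \<noteq> \<infinity>}"

definition csiszar_class :: "(real \<Rightarrow> ereal) set" where
  "csiszar_class = {f. proper_convex f \<and> edom f \<subseteq> {0..} \<and> (f \<longlongrightarrow> f 0) (at_right 0) \<and>
     f 1 = 0 \<and> 1 \<in> interior (edom f)}"

text \<open>The value \<open>f\<^sup>*(0)\<close>: the slope of \<open>f\<close> at infinity.\<close>

definition fstar0 :: "(real \<Rightarrow> ereal) \<Rightarrow> ereal" where
  "fstar0 f = Lim at_top (\<lambda>t. f t / ereal t)"


section \<open>Derivative of measures that need not be absolutely continuous\<close>

definition sum_measure :: "'a measure \<Rightarrow> 'a measure \<Rightarrow> 'a measure" where
  "sum_measure P Q = measure_of (space P) (sets P) (\<lambda>A. emeasure P A + emeasure Q A)"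

text \<open>The ratio \<open>p / q\<close> of densities, computed with the dominating measure \<open>P + Q\<close>; by
  \<open>gen_deriv_AE_eq\<close> below, any other \<open>\<sigma>\<close>-finite dominating measure and any other densities
  give the same ratio \<open>(P + Q)\<close>-almost everywhere. Division on \<^typ>\<open>ennreal\<close>
  satisfies \<open>0 / 0 = 0\<close> and \<open>a / 0 = \<infinity>\<close> for \<open>a > 0\<close>.\<close>

definition gen_deriv :: "'a measure \<Rightarrow> 'a measure \<Rightarrow> 'a \<Rightarrow> ennreal" where
  "gen_deriv P Q x = RN_deriv (sum_measure P Q) P x / RN_deriv (sum_measure P Q) Q x"

lemma space_sum_measure [simp]: "space (sum_measure P Q) = space P"
  by (simp add: sum_measure_def)

lemma sets_sum_measure [simp, measurable_cong]: "sets (sum_measure P Q) = sets P"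
  by (simp add: sum_measure_def)

lemma emeasure_sum_measure:
  assumes "sets Q = sets P" "A \<in> sets P"
  shows "emeasure (sum_measure P Q) A = emeasure P A + emeasure Q A"
proof (rule emeasure_measure_of[OF sum_measure_def])
  show "countably_additive (sets (sum_measure P Q)) (\<lambda>A. emeasure P A + emeasure Q A)"
    using assms(1)
    by (auto simp: countably_additive_def suminf_add[symmetric] suminf_emeasure image_subset_iff)
qed (use assms sets.sets_into_space in \<open>auto simp: positive_def\<close>)

lemma gen_deriv_AE_eq:
  assumes "sigma_finite_measure \<mu>"
    and [measurable]: "p \<in> borel_measurable \<mu>" "q \<in> borel_measurable \<mu>"
    and P: "P = density \<mu> p" and Q: "Q = density \<mu> q"
    and "finite_measure P" "finite_measure Q"
  shows "AE x in sum_measure P Q. gen_deriv P Q x = p x / q x"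
proof -
  interpret sigma_finite_measure \<mu> by fact
  interpret P: finite_measure P by fact
  interpret Q: finite_measure Q by fact
  define M where "M = sum_measure P Q"
  have setsM [measurable_cong, simp]: "sets M = sets \<mu>" by (simp add: M_def P)
  have M: "M = density \<mu> (\<lambda>x. p x + q x)"
  proof (rule measure_eqI)
    fix A assume "A \<in> sets M"
    then have [measurable]: "A \<in> sets \<mu>" by simp
    have "emeasure M A = emeasure P A + emeasure Q A"
      unfolding M_def by (rule emeasure_sum_measure) (simp_all add: P Q)
    then show "emeasure M A = emeasure (density \<mu> (\<lambda>x. p x + q x)) A"
      by (simp add: P Q emeasure_density distrib_right nn_integral_add)
  qed simp
  have finM: "finite_measure M"
    by (rule finite_measureI)
       (use P.emeasure_finite[of "space P"] Q.emeasure_finite[of "space P"] in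
         \<open>auto simp: M_def emeasure_sum_measure P Q\<close>)
  interpret M: finite_measure M by fact
  have fin: "AE x in \<mu>. p x + q x \<noteq> \<infinity>"
  proof (rule nn_integral_PInf_AE)
    have "(\<integral>\<^sup>+ x. p x + q x \<partial>\<mu>) = emeasure M (space \<mu>)"
      by (simp add: M emeasure_density nn_integral_set_ennreal[symmetric] cong: nn_integral_cong)
    then show "(\<integral>\<^sup>+ x. p x + q x \<partial>\<mu>) \<noteq> \<infinity>" by simp
  qed simp
  have *: "AE x in \<mu>. r x = (p x + q x) * RN_deriv M R x"
    if [measurable]: "r \<in> borel_measurable \<mu>" and R: "R = density \<mu> r"
      and le: "\<And>x. r x \<le> p x + q x" for r R
  proof -
    have "absolutely_continuous M R" unfolding absolutely_continuous_def
    proof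
      fix A assume "A \<in> null_sets M"
      then have "A \<in> sets \<mu>" and "AE x in \<mu>. x \<in> A \<longrightarrow> p x + q x = 0"
        by (auto simp: M null_sets_density_iff)
      moreover from this(2) have "AE x in \<mu>. x \<in> A \<longrightarrow> r x = 0"
        by eventually_elim (metis le le_zero_eq)
      ultimately show "A \<in> null_sets R" by (simp add: R null_sets_density_iff)
    qed
    then have "density M (RN_deriv M R) = R"
      by (rule M.density_RN_deriv) (simp add: R)
    then have "density \<mu> (\<lambda>x. (p x + q x) * RN_deriv M R x) = density \<mu> r"
      using R by (subst (asm) (1) M) (simp add: density_density_eq)
    then show ?thesis
      by (subst (asm) density_unique_iff) auto
  qed
  have Pd: "AE x in \<mu>. p x = (p x + q x) * RN_deriv M P x"
    and Qd: "AE x in \<mu>. q x = (p x + q x) * RN_deriv M Q x"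
    by (rule *; simp add: P Q)+
  have "AE x in \<mu>. 0 < p x + q x \<longrightarrow> gen_deriv P Q x = p x / q x"
    using fin Pd Qd
  proof eventually_elim
    case (elim x)
    define s where "s = p x + q x"
    have "p x / q x = (s * RN_deriv M P x) / (s * RN_deriv M Q x)"
      using elim by (simp add: s_def)
    also have "\<dots> = RN_deriv M P x / RN_deriv M Q x" if "0 < s"
      using elim(1) that unfolding s_def[symmetric]
      by (simp add: divide_mult_eq[of s] zero_less_iff_neq_zero mult.commute[of s])
    finally show ?case by (simp add: gen_deriv_def M_def s_def)
  qed
  then show ?thesis
    unfolding M_def[symmetric] by (subst M) (simp add: AE_density)
qed


section \<open>Divergence and Csiszar index\<close>

definition ereal_integral :: "'a measure \<Rightarrow> ('a \<Rightarrow> ereal) \<Rightarrow> ereal" where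
  "ereal_integral M g =
     enn2ereal (\<integral>\<^sup>+ x. e2ennreal (g x) \<partial>M) - enn2ereal (\<integral>\<^sup>+ x. e2ennreal (- g x) \<partial>M)"

text \<open>The map \<^const>\<open>e2ennreal\<close> truncates negative values to \<open>0\<close>, so the two terms above are
  the integrals of the positive and of the negative part. For \<open>f\<close> in \<^const>\<open>csiszar_class\<close> and
  probability measures \<open>P\<close>, \<open>Q\<close> the second one is finite below, as \<open>f\<close> has an affine minorant.

  In the first summand, \<^const>\<open>enn2real\<close> alters the derivative only where it is \<open>\<infinity>\<close>, that is on
  a \<open>Q\<close>-null set. If \<open>P\<close> is absolutely continuous with respect to \<open>Q\<close>, then the second summand is
  \<open>0\<close> even for \<open>f\<^sup>*(0) = \<infinity>\<close>, because \<open>\<infinity> * 0 = 0\<close> in \<^typ>\<open>ereal\<close>.\<close>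

definition csiszar_div :: "(real \<Rightarrow> ereal) \<Rightarrow> 'a measure \<Rightarrow> 'a measure \<Rightarrow> ereal" where
  "csiszar_div f P Q =
     ereal_integral Q (\<lambda>x. f (enn2real (gen_deriv P Q x))) +
     fstar0 f * enn2ereal (emeasure P {x \<in> space P. gen_deriv P Q x = \<infinity>})"

abbreviation product_law ::
  "'w measure \<Rightarrow> 'a measure \<Rightarrow> 'b measure \<Rightarrow> ('w \<Rightarrow> 'a) \<Rightarrow> ('w \<Rightarrow> 'b) \<Rightarrow> ('a \<times> 'b) measure" where
  "product_law M S T X Y \<equiv> distr M S X \<Otimes>\<^sub>M distr M T Y"

abbreviation joint_law ::
  "'w measure \<Rightarrow> 'a measure \<Rightarrow> 'b measure \<Rightarrow> ('w \<Rightarrow> 'a) \<Rightarrow> ('w \<Rightarrow> 'b) \<Rightarrow> ('a \<times> 'b) measure" where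
  "joint_law M S T X Y \<equiv> distr M (S \<Otimes>\<^sub>M T) (\<lambda>\<omega>. (X \<omega>, Y \<omega>))"

definition csiszar_index ::
  "(real \<Rightarrow> ereal) \<Rightarrow> 'w measure \<Rightarrow> 'a measure \<Rightarrow> 'b measure \<Rightarrow> ('w \<Rightarrow> 'a) \<Rightarrow> ('w \<Rightarrow> 'b) \<Rightarrow> ereal" where
  "csiszar_index f M S T X Y = csiszar_div f (product_law M S T X Y) (joint_law M S T X Y)"


section \<open>Bi-measurable maps and conditional distributions\<close>

definition bi_measurable :: "('a \<Rightarrow> 'b) \<Rightarrow> 'a measure \<Rightarrow> 'b measure \<Rightarrow> bool" where
  "bi_measurable \<phi> S E \<longleftrightarrow> (\<forall>A\<in>sets S. \<phi> ` A \<in> sets E)"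

text \<open>\<open>is_cond_distr M S T Y W \<kappa>\<close>: the Markov kernel \<open>\<kappa>\<close> from \<open>S\<close> to \<open>T\<close> is a version of the
  conditional distribution of \<open>W\<close> given \<open>Y\<close>. The right-hand side of the equation is the measure
  \<open>P\<^sub>Y(dy) \<kappa>(y)(dw)\<close> on the product space, written in the Giry monad.\<close>

definition is_cond_distr ::
  "'w measure \<Rightarrow> 'a measure \<Rightarrow> 'b measure \<Rightarrow> ('w \<Rightarrow> 'a) \<Rightarrow> ('w \<Rightarrow> 'b) \<Rightarrow> ('a \<Rightarrow> 'b measure) \<Rightarrow> bool" where
  "is_cond_distr M S T Y W \<kappa> \<longleftrightarrow>
     \<kappa> \<in> S \<rightarrow>\<^sub>M prob_algebra T \<and>
     joint_law M S T Y W =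
       distr M S Y \<bind> (\<lambda>y. \<kappa> y \<bind> (\<lambda>w. return (S \<Otimes>\<^sub>M T) (y, w)))"

end

theory Submission
  imports Defs
begin

text \<open>
  The map \<open>T\<close> is called sufficient for the pair \<open>(P, Q)\<close> if \<open>dP/dQ = h \<circ> T\<close> holds
  \<open>(P + Q)\<close>-almost everywhere for some measurable \<open>h\<close>. All three invariance properties say that
  passing from \<open>(P, Q)\<close> to the images under a sufficient \<open>T\<close> does not change the divergence.

  This principle is \<open>csiszar_div_distr\<close>. With respect to \<open>P + Q\<close>, the densities \<open>p\<close> and \<open>q\<close> of
  \<open>P\<close> and \<open>Q\<close> satisfy \<open>p + q = 1\<close>, so they are functions of the ratio: \<open>q = 1 / (1 + p/q)\<close>,
  also where \<open>p/q = \<infinity>\<close>. If the ratio factors through \<open>T\<close>, so do \<open>p\<close> and \<open>q\<close>, and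
  the factors are densities of the images with respect to the image of \<open>P + Q\<close>. Hence the derivative
  of the images, composed with \<open>T\<close>, is \<open>dP/dQ\<close> again (\<open>gen_deriv_distr\<close>), and both summands of the
  divergence are preserved by change of variables. That the integrand is measurable follows from
  the convexity of \<open>f\<close>: the sublevel sets are intervals.

  It remains to see why \<open>T\<close> is sufficient in each case, with \<open>P\<close> the product law and \<open>Q\<close> the joint law.
  For marginal invariance, \<open>T = \<phi>\<^sub>1 \<times> \<phi>\<^sub>2\<close>, and the product of the \<open>\<sigma>\<close>-algebras generated by
  \<open>\<phi>\<^sub>1\<close> and \<open>\<phi>\<^sub>2\<close> lies in the one generated by \<open>T\<close>, so the Doob--Dynkin lemma
  (\<open>factor_through_vimage_algebra\<close>) provides \<open>h\<close>. An injective bi-measurable map generates the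
  whole \<open>\<sigma>\<close>-algebra of its domain, so invariance by injection is the special case in which the
  measurability assumption is automatic.

  For Markovian kernels, both laws of \<open>((Y\<^sub>1, W\<^sub>1), (Y\<^sub>2, W\<^sub>2))\<close> arise from the corresponding laws of
  \<open>(Y\<^sub>1, Y\<^sub>2)\<close> by one and the same kernel: draw \<open>w\<^sub>1\<close> and \<open>w\<^sub>2\<close> independently from
  \<open>\<kappa>\<^sub>1 y\<^sub>1\<close> and \<open>\<kappa>\<^sub>2 y\<^sub>2\<close>, and keep \<open>(y\<^sub>1, y\<^sub>2)\<close>. For the product law this is
  Fubini's theorem, for the joint law it is the hypothesis. A common kernel from which the starting
  point can be read off leaves the ratio of densities unchanged, so the projection onto
  \<open>(y\<^sub>1, y\<^sub>2)\<close> is sufficient (\<open>csiszar_div_bind_fibre\<close>).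
\<close>

section \<open>Measurability of convex functions\<close>

text \<open>Every sublevel set is convex, hence an interval, hence a Borel set.\<close>

lemma proper_convex_borel_measurable:
  assumes "proper_convex f"
  shows "f \<in> borel_measurable borel"
proof (rule borel_measurableI_le)
  fix a :: ereal
  have "is_interval {x. f x \<le> a}"
    unfolding is_interval_convex_1
  proof (rule convexI)
    fix x y u v :: real
    assume x: "x \<in> {x. f x \<le> a}" and y: "y \<in> {x. f x \<le> a}" and uv: "0 \<le> u" "0 \<le> v" "u + v = 1"
    have "f ((1 - v) * x + v * y) \<le> ereal (1 - v) * f x + ereal v * f y"
      using assms uv unfolding proper_convex_def by auto
    also have "\<dots> \<le> ereal (1 - v) * a + ereal v * a"
      using x y uv by (intro add_mono ereal_mult_left_mono) auto
    also have "\<dots> = (ereal (1 - v) + ereal v) * a"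
      using uv by (intro ereal_left_distrib[symmetric]) auto
    also have "\<dots> = a" by (simp flip: one_ereal_def)
    finally show "u *\<^sub>R x + v *\<^sub>R y \<in> {x. f x \<le> a}"
      using uv by (simp add: eq_diff_eq[symmetric])
  qed
  then show "{x \<in> space borel. f x \<le> a} \<in> sets borel"
    using real_interval_borel_measurable by simp
qed

section \<open>The sum of two measures\<close>

lemma finite_measure_sum_measure:
  assumes "finite_measure P" "finite_measure Q" "sets Q = sets P"
  shows "finite_measure (sum_measure P Q)"
  using assms finite_measure.emeasure_finite[OF assms(1)] finite_measure.emeasure_finite[OF assms(2)]
  by (intro finite_measureI) (simp add: emeasure_sum_measure)

lemma AE_sum_measureD:
  assumes "sets Q = sets P" "AE x in sum_measure P Q. R x"
  shows "AE x in P. R x" "AE x in Q. R x"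
proof -
  from assms(2) obtain N where N: "{x \<in> space P. \<not> R x} \<subseteq> N" "emeasure (sum_measure P Q) N = 0" "N \<in> sets P"
    by (auto elim!: AE_E)
  then have "emeasure P N = 0" "emeasure Q N = 0"
    by (simp_all add: emeasure_sum_measure assms(1))
  with N show "AE x in P. R x" "AE x in Q. R x"
    using assms(1) sets_eq_imp_space_eq[OF assms(1)] by (auto intro!: AE_I'[of N] simp: null_sets_def)
qed

lemma absolutely_continuous_sum_measure:
  assumes "sets Q = sets P"
  shows "absolutely_continuous (sum_measure P Q) P" "absolutely_continuous (sum_measure P Q) Q"
  using assms by (auto simp: absolutely_continuous_def null_sets_def emeasure_sum_measure)

lemma nn_integral_sum_measure:
  assumes "sets Q = sets P" and g: "g \<in> borel_measurable P"
  shows "(\<integral>\<^sup>+ x. g x \<partial>sum_measure P Q) = (\<integral>\<^sup>+ x. g x \<partial>P) + (\<integral>\<^sup>+ x. g x \<partial>Q)"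
  using g
proof (induction rule: borel_measurable_induct)
  case (cong f g)
  have "integral\<^sup>N R f = integral\<^sup>N R g" if "space R = space P" for R :: "'a measure"
    using cong(3) that by (intro nn_integral_cong) simp
  from this[of P] this[of Q] this[of "sum_measure P Q"] cong(4) show ?case
    using sets_eq_imp_space_eq[OF assms(1)] by simp
next
  case (set A)
  then show ?case by (simp add: emeasure_sum_measure assms(1))
next
  case (mult u c)
  then have [measurable]: "u \<in> borel_measurable Q" "u \<in> borel_measurable (sum_measure P Q)"
    by (simp_all add: measurable_cong_sets[OF assms(1) refl] measurable_cong_sets[OF sets_sum_measure refl])
  show ?case using mult by (simp add: nn_integral_cmult distrib_left)
next
  case (add u v)
  then have [measurable]: "u \<in> borel_measurable Q" "u \<in> borel_measurable (sum_measure P Q)"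
    "v \<in> borel_measurable Q" "v \<in> borel_measurable (sum_measure P Q)"
    by (simp_all add: measurable_cong_sets[OF assms(1) refl] measurable_cong_sets[OF sets_sum_measure refl])
  show ?case using add by (simp add: nn_integral_add ac_simps)
next
  case (seq U)
  note [measurable] = seq(1)
  have [measurable]: "U i \<in> borel_measurable Q" "U i \<in> borel_measurable (sum_measure P Q)" for i
    using seq(1)[of i]
    by (simp_all add: measurable_cong_sets[OF assms(1) refl] measurable_cong_sets[OF sets_sum_measure refl])
  have inc: "incseq (\<lambda>i. \<integral>\<^sup>+ x. U i x \<partial>R)" for R
    using \<open>incseq U\<close> by (auto simp: incseq_def le_fun_def intro!: nn_integral_mono)
  show ?case
    unfolding SUP_apply image_comp o_def
    using seq.IH \<open>incseq U\<close>
    by (simp add: nn_integral_monotone_convergence_SUP SUP_apply ennreal_SUP_add inc)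
qed

lemma measurable_gen_deriv:
  assumes "sets Q = sets P"
  shows "gen_deriv P Q \<in> borel_measurable P"
proof -
  have "gen_deriv P Q \<in> borel_measurable (sum_measure P Q)"
    unfolding gen_deriv_def by measurable
  then show ?thesis by (simp add: measurable_cong_sets[OF sets_sum_measure refl])
qed

section \<open>Divergences under images along a sufficient map\<close>

text \<open>Normalised densities are functions of their ratio. The second one is written as \<open>1 - q\<close>
  and not as \<open>(p / q) * q\<close>, because the latter is \<open>\<infinity> * 0 = 0\<close> at \<open>q = 0\<close>, where \<open>p = 1\<close>.\<close>

lemma densities_from_ratio:
  fixes p q :: ennreal
  assumes "p + q = 1"
  shows "q = inverse (1 + p / q)" "p = 1 - inverse (1 + p / q)"
proof -
  have q: "q \<noteq> \<infinity>" using assms by (metis ennreal_add_eq_top infinity_ennreal_def ennreal_one_neq_top)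
  show *: "q = inverse (1 + p / q)"
  proof (cases "q = 0")
    case True
    then show ?thesis using assms by simp
  next
    case False
    then have "1 + p / q = (q + p) / q"
      using q by (simp add: add_divide_distrib_ennreal ennreal_divide_self top.not_eq_extremum)
    also have "\<dots> = inverse q"
      using assms by (simp add: add.commute divide_ennreal_def)
    finally have "inverse (1 + p / q) = inverse (inverse q)" by simp
    also have "\<dots> = q"
      using False q by (cases q) (auto simp: inverse_ennreal)
    finally show ?thesis by simp
  qed
  have "p = (p + q) - q"
    using q by simp
  with * assms show "p = 1 - inverse (1 + p / q)" by simp
qed

lemma distr_sum_measure:
  assumes "sets Q = sets P" "T \<in> P \<rightarrow>\<^sub>M B"
  shows "sum_measure (distr P B T) (distr Q B T) = distr (sum_measure P Q) B T"
proof (rule measure_eqI)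
  have [measurable]: "T \<in> P \<rightarrow>\<^sub>M B" "T \<in> Q \<rightarrow>\<^sub>M B" "T \<in> sum_measure P Q \<rightarrow>\<^sub>M B"
    using assms by (simp_all add: measurable_cong_sets[OF assms(1) refl] measurable_cong_sets[OF sets_sum_measure refl])
  fix A assume "A \<in> sets (sum_measure (distr P B T) (distr Q B T))"
  then have [measurable]: "A \<in> sets B" by simp
  have "T -` A \<inter> space P \<in> sets P" by measurable
  then show "emeasure (sum_measure (distr P B T) (distr Q B T)) A = emeasure (distr (sum_measure P Q) B T) A"
    using assms(1) sets_eq_imp_space_eq[OF assms(1)]
    by (simp add: emeasure_sum_measure emeasure_distr)
qed simp

text \<open>Since \<open>h\<close> determines \<open>p\<close> and \<open>q\<close>, the densities factor through \<open>T\<close> as well. The factors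
  \<open>a\<close> and \<open>b\<close> are then densities of the image measures, and \<open>a / b\<close> composed with \<open>T\<close> is \<open>p / q\<close>.\<close>

lemma gen_deriv_distr:
  assumes fin: "finite_measure P" "finite_measure Q" and sets: "sets Q = sets P"
    and T: "T \<in> P \<rightarrow>\<^sub>M B" and h[measurable]: "h \<in> borel_measurable B"
    and suff: "AE x in sum_measure P Q. gen_deriv P Q x = h (T x)"
  shows "AE x in sum_measure P Q. gen_deriv (distr P B T) (distr Q B T) (T x) = gen_deriv P Q x"
proof -
  define \<mu> where "\<mu> = sum_measure P Q"
  define p where "p = RN_deriv \<mu> P"
  define q where "q = RN_deriv \<mu> Q"
  interpret \<mu>: finite_measure \<mu>
    unfolding \<mu>_def using fin sets by (rule finite_measure_sum_measure)
  have [measurable]: "T \<in> \<mu> \<rightarrow>\<^sub>M B"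
    using T by (simp add: \<mu>_def measurable_cong_sets[OF sets_sum_measure refl])
  have [measurable]: "p \<in> borel_measurable \<mu>" "q \<in> borel_measurable \<mu>"
    by (simp_all add: p_def q_def)
  have P: "density \<mu> p = P" and Q: "density \<mu> q = Q"
    unfolding p_def q_def using absolutely_continuous_sum_measure[OF sets]
    by (auto intro!: \<mu>.density_RN_deriv simp: sets \<mu>_def[symmetric]) (simp_all add: \<mu>_def sets)
  have "density \<mu> (\<lambda>x. p x + q x) = density \<mu> (\<lambda>x. 1)"
  proof (rule measure_eqI)
    fix A assume "A \<in> sets (density \<mu> (\<lambda>x. p x + q x))"
    then have [measurable]: "A \<in> sets \<mu>" by simp
    have "emeasure (density \<mu> (\<lambda>x. p x + q x)) A = emeasure (density \<mu> p) A + emeasure (density \<mu> q) A"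
      by (simp add: emeasure_density distrib_right nn_integral_add)
    also have "\<dots> = emeasure \<mu> A"
      using \<open>A \<in> sets \<mu>\<close> unfolding P Q by (simp add: \<mu>_def emeasure_sum_measure sets)
    finally show "emeasure (density \<mu> (\<lambda>x. p x + q x)) A = emeasure (density \<mu> (\<lambda>x. 1)) A"
      by (simp add: emeasure_density)
  qed simp
  then have "AE x in \<mu>. p x + q x = 1"
    by (subst (asm) \<mu>.density_unique_iff) auto
  with suff have pq: "AE x in \<mu>. q x = inverse (1 + h (T x)) \<and> p x = 1 - inverse (1 + h (T x))"
    unfolding \<mu>_def[symmetric]
  proof eventually_elim
    case (elim x)
    have "h (T x) = p x / q x"
      using elim(1) by (simp add: gen_deriv_def p_def q_def \<mu>_def)
    with densities_from_ratio[OF elim(2)] show ?case by simp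
  qed
  define a where "a y = 1 - inverse (1 + h y)" for y
  define b where "b y = inverse (1 + h y)" for y
  have [measurable]: "a \<in> borel_measurable B" "b \<in> borel_measurable B"
    unfolding a_def b_def by measurable
  have "density \<mu> (\<lambda>x. a (T x)) = P" "density \<mu> (\<lambda>x. b (T x)) = Q"
    using pq by (auto simp: P[symmetric] Q[symmetric] a_def b_def intro!: density_cong)
  then have dist: "distr P B T = density (distr \<mu> B T) a" "distr Q B T = density (distr \<mu> B T) b"
    by (simp_all add: density_distr)
  have fin': "finite_measure (distr P B T)" "finite_measure (distr Q B T)" "finite_measure (distr \<mu> B T)"
    using fin T by (auto intro!: finite_measure.finite_measure_distr \<mu>.finite_measure_distr
        simp: measurable_cong_sets[OF sets refl])
  have "AE y in sum_measure (distr P B T) (distr Q B T). gen_deriv (distr P B T) (distr Q B T) y = a y / b y"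
    by (rule gen_deriv_AE_eq[OF _ _ _ dist fin'(1,2)])
       (use fin'(3) in \<open>auto simp: finite_measure.axioms\<close>)
  then have "AE y in distr \<mu> B T. gen_deriv (distr P B T) (distr Q B T) y = a y / b y"
    unfolding distr_sum_measure[OF sets T] \<mu>_def[symmetric] .
  then have "AE x in \<mu>. gen_deriv (distr P B T) (distr Q B T) (T x) = a (T x) / b (T x)"
    by (rule AE_distrD[rotated]) simp
  with pq show ?thesis
    unfolding \<mu>_def[symmetric]
  proof eventually_elim
    case (elim x)
    then show ?case by (simp add: gen_deriv_def a_def b_def p_def q_def \<mu>_def)
  qed
qed

text \<open>The principle behind all three invariance properties: passing to images under a sufficient map
  preserves the divergence. Each of its two terms is an integral of a function of the derivative.\<close>

lemma csiszar_div_distr: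
  assumes f[measurable]: "f \<in> borel_measurable borel"
    and fin: "finite_measure P" "finite_measure Q" and sets: "sets Q = sets P"
    and T: "T \<in> P \<rightarrow>\<^sub>M B" and h: "h \<in> borel_measurable B"
    and suff: "AE x in sum_measure P Q. gen_deriv P Q x = h (T x)"
  shows "csiszar_div f (distr P B T) (distr Q B T) = csiszar_div f P Q"
proof -
  define r where "r = gen_deriv P Q"
  define r' where "r' = gen_deriv (distr P B T) (distr Q B T)"
  note T[measurable]
  have [measurable]: "T \<in> Q \<rightarrow>\<^sub>M B" using T by (simp add: measurable_cong_sets[OF sets refl])
  have [measurable]: "r \<in> borel_measurable P" using measurable_gen_deriv[OF sets] by (simp add: r_def)
  have [measurable]: "r' \<in> borel_measurable B"
    using measurable_gen_deriv[of "distr Q B T" "distr P B T"] by (simp add: r'_def)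
  have "AE x in sum_measure P Q. r' (T x) = r x"
    unfolding r_def r'_def by (rule gen_deriv_distr[OF fin sets T h suff])
  then have eq: "AE x in P. r' (T x) = r x" "AE x in Q. r' (T x) = r x"
    using AE_sum_measureD[OF sets] by auto
  have int: "(\<integral>\<^sup>+ y. F (r' y) \<partial>distr Q B T) = (\<integral>\<^sup>+ x. F (r x) \<partial>Q)"
    if [measurable]: "F \<in> borel_measurable borel" for F :: "ennreal \<Rightarrow> ennreal"
  proof -
    have "(\<integral>\<^sup>+ y. F (r' y) \<partial>distr Q B T) = (\<integral>\<^sup>+ x. F (r' (T x)) \<partial>Q)"
      by (rule nn_integral_distr) measurable
    also have "\<dots> = (\<integral>\<^sup>+ x. F (r x) \<partial>Q)"
      using eq(2) by (intro nn_integral_cong_AE) auto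
    finally show ?thesis .
  qed
  have "ereal_integral (distr Q B T) (\<lambda>y. f (enn2real (r' y))) = ereal_integral Q (\<lambda>x. f (enn2real (r x)))"
    unfolding ereal_integral_def
    using int[of "\<lambda>t. e2ennreal (f (enn2real t))"] int[of "\<lambda>t. e2ennreal (- f (enn2real t))"]
    by simp
  moreover have "emeasure (distr P B T) {y \<in> space (distr P B T). r' y = \<infinity>} = emeasure P {x \<in> space P. r x = \<infinity>}"
  proof -
    have "emeasure (distr P B T) {y \<in> space (distr P B T). r' y = \<infinity>}
        = emeasure P (T -` {y \<in> space B. r' y = \<infinity>} \<inter> space P)"
      unfolding space_distr by (rule emeasure_distr) measurable
    also have "\<dots> = emeasure P {x \<in> space P. r x = \<infinity>}"
    proof (rule emeasure_eq_AE)
      show "AE x in P. (x \<in> T -` {y \<in> space B. r' y = \<infinity>} \<inter> space P) = (x \<in> {x \<in> space P. r x = \<infinity>})"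
        using eq(1) AE_space by eventually_elim (use measurable_space[OF T] in auto)
    qed measurable
    finally show ?thesis .
  qed
  ultimately show ?thesis by (simp add: csiszar_div_def r_def r'_def)
qed

section \<open>Marginal invariance and invariance by injection\<close>

text \<open>The Doob--Dynkin lemma for nonnegative functions. The functions of the form \<open>h \<circ> T\<close> contain the
  indicators and are closed under sums, multiples and increasing limits.\<close>

lemma factor_through_vimage_algebra:
  fixes g :: "'a \<Rightarrow> ennreal"
  assumes T: "T \<in> X \<rightarrow> space N" and g: "g \<in> borel_measurable (vimage_algebra X T N)"
  shows "\<exists>h\<in>borel_measurable N. \<forall>x\<in>X. g x = h (T x)"
  using g
proof (induction rule: borel_measurable_induct)
  case (cong f g)
  then obtain h where "h \<in> borel_measurable N" "\<forall>x\<in>X. g x = h (T x)" by blast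
  with cong(3) show ?case by (intro bexI[of _ h]) (simp_all add: space_vimage_algebra)
next
  case (set A)
  then obtain C where C: "C \<in> sets N" "A = T -` C \<inter> X"
    unfolding sets_vimage_algebra2[OF T] by blast
  show ?case
  proof (intro bexI ballI)
    show "indicator A x = indicator C (T x)" if "x \<in> X" for x
      using that by (simp add: C(2) indicator_def)
    show "indicator C \<in> borel_measurable N"
      using C(1) by measurable
  qed
next
  case (mult u c)
  from mult.IH obtain h where h: "h \<in> borel_measurable N" "\<And>x. x \<in> X \<Longrightarrow> u x = h (T x)" by blast
  then show ?case
    by (intro bexI[of _ "\<lambda>y. c * h y"] ballI) (simp_all only: borel_measurable_times_ennreal borel_measurable_const)
next
  case (add u v)
  from add.IH obtain h k where h: "h \<in> borel_measurable N" "\<And>x. x \<in> X \<Longrightarrow> u x = h (T x)"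
    and k: "k \<in> borel_measurable N" "\<And>x. x \<in> X \<Longrightarrow> v x = k (T x)" by blast
  then show ?case
    by (intro bexI[of _ "\<lambda>y. k y + h y"] ballI) (simp_all only: borel_measurable_add)
next
  case (seq U)
  have *: "\<forall>i. \<exists>h. h \<in> borel_measurable N \<and> (\<forall>x\<in>X. U i x = h (T x))"
    using seq.IH by blast
  then obtain h where h: "\<And>i. h i \<in> borel_measurable N" "\<And>i x. x \<in> X \<Longrightarrow> U i x = h i (T x)"
    using choice[OF *] by blast
  show ?case
  proof (intro bexI ballI)
    show "(SUP i. U i) x = (SUP i. h i (T x))" if "x \<in> X" for x
      using h(2)[OF that] by (simp add: SUP_apply image_comp)
    show "(\<lambda>y. SUP i. h i y) \<in> borel_measurable N"
      using h(1) by measurable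
  qed
qed

text \<open>A rectangle of preimages is the preimage of a rectangle.\<close>

lemma sets_pair_vimage_algebra_subset:
  assumes "\<phi> \<in> A \<rightarrow> space M" "\<psi> \<in> B \<rightarrow> space N"
  shows "sets (vimage_algebra A \<phi> M \<Otimes>\<^sub>M vimage_algebra B \<psi> N)
    \<subseteq> sets (vimage_algebra (A \<times> B) (\<lambda>(x, y). (\<phi> x, \<psi> y)) (M \<Otimes>\<^sub>M N))"
    (is "_ \<subseteq> sets ?V")
proof -
  have "a \<times> b \<in> sets ?V" if "a \<in> sets (vimage_algebra A \<phi> M)" "b \<in> sets (vimage_algebra B \<psi> N)" for a b
  proof -
    obtain c d where cd: "c \<in> sets M" "d \<in> sets N" and ab: "a = \<phi> -` c \<inter> A" "b = \<psi> -` d \<inter> B"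
      using \<open>a \<in> _\<close> \<open>b \<in> _\<close> assms by (auto simp: sets_vimage_algebra2)
    have "a \<times> b = (\<lambda>(x, y). (\<phi> x, \<psi> y)) -` (c \<times> d) \<inter> (A \<times> B)"
      by (auto simp: ab)
    also have "\<dots> \<in> sets ?V"
      using cd by (intro in_vimage_algebra) auto
    finally show ?thesis .
  qed
  then have "{a \<times> b | a b. a \<in> sets (vimage_algebra A \<phi> M) \<and> b \<in> sets (vimage_algebra B \<psi> N)} \<subseteq> sets ?V"
    by blast
  from sets.sigma_sets_subset[OF this] show ?thesis
    unfolding sets_pair_measure space_vimage_algebra .
qed

text \<open>By injectivity \<open>A\<close> is the preimage of its image, and that image is measurable.\<close>

lemma bi_measurable_sets_eq:
  assumes "\<phi> \<in> S \<rightarrow>\<^sub>M E" "inj_on \<phi> (space S)" "bi_measurable \<phi> S E"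
  shows "sets (vimage_algebra (space S) \<phi> E) = sets S"
proof (intro equalityI subsetI)
  fix A assume "A \<in> sets (vimage_algebra (space S) \<phi> E)"
  then show "A \<in> sets S"
    using sets_image_in_sets[OF refl assms(1)] by auto
next
  fix A assume A: "A \<in> sets S"
  then have "\<phi> -` (\<phi> ` A) \<inter> space S \<in> sets (vimage_algebra (space S) \<phi> E)"
    using assms(3) by (auto simp: bi_measurable_def intro: in_vimage_algebra)
  moreover have "\<phi> -` (\<phi> ` A) \<inter> space S = A"
    using sets.sets_into_space[OF A] assms(2) by (auto dest: inj_onD)
  ultimately show "A \<in> sets (vimage_algebra (space S) \<phi> E)" by simp
qed

lemma csiszar_index_marginal:
  assumes f: "f \<in> borel_measurable borel" and M: "prob_space M"
    and X[measurable]: "X1 \<in> M \<rightarrow>\<^sub>M S1" "X2 \<in> M \<rightarrow>\<^sub>M S2"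
    and \<phi>[measurable]: "\<phi>1 \<in> S1 \<rightarrow>\<^sub>M E1" "\<phi>2 \<in> S2 \<rightarrow>\<^sub>M E2"
    and g: "g \<in> borel_measurable
      (vimage_algebra (space S1) \<phi>1 E1 \<Otimes>\<^sub>M vimage_algebra (space S2) \<phi>2 E2)"
    and suff: "AE z in sum_measure (product_law M S1 S2 X1 X2) (joint_law M S1 S2 X1 X2).
      g z = gen_deriv (product_law M S1 S2 X1 X2) (joint_law M S1 S2 X1 X2) z"
  shows "csiszar_index f M S1 S2 X1 X2
    = csiszar_index f M E1 E2 (\<lambda>\<omega>. \<phi>1 (X1 \<omega>)) (\<lambda>\<omega>. \<phi>2 (X2 \<omega>))"
proof -
  interpret M: prob_space M by fact
  let ?P = "product_law M S1 S2 X1 X2" and ?Q = "joint_law M S1 S2 X1 X2"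
  let ?T = "\<lambda>(x, y). (\<phi>1 x, \<phi>2 y)"
  interpret D1: prob_space "distr M S1 X1" by (rule M.prob_space_distr) fact
  interpret D2: prob_space "distr M S2 X2" by (rule M.prob_space_distr) fact
  interpret P: pair_prob_space "distr M S1 X1" "distr M S2 X2" ..
  interpret Q: prob_space ?Q by (rule M.prob_space_distr) measurable
  have sets: "sets ?Q = sets ?P" by (simp cong: sets_pair_measure_cong)
  have T: "?T \<in> ?P \<rightarrow>\<^sub>M E1 \<Otimes>\<^sub>M E2" by measurable
  have sub: "\<phi>1 \<in> space S1 \<rightarrow> space E1" "\<phi>2 \<in> space S2 \<rightarrow> space E2"
    using measurable_space[OF \<phi>(1)] measurable_space[OF \<phi>(2)] by auto
  have "g \<in> borel_measurable (vimage_algebra (space S1 \<times> space S2) ?T (E1 \<Otimes>\<^sub>M E2))"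
    using measurable_sets[OF g] sets_pair_vimage_algebra_subset[OF sub]
    by (auto simp: measurable_def space_pair_measure)
  moreover have "?T \<in> space S1 \<times> space S2 \<rightarrow> space (E1 \<Otimes>\<^sub>M E2)"
    using sub by (auto simp: space_pair_measure)
  ultimately have "\<exists>h\<in>borel_measurable (E1 \<Otimes>\<^sub>M E2). \<forall>z\<in>space S1 \<times> space S2. g z = h (?T z)"
    by (rule factor_through_vimage_algebra[rotated])
  then obtain h where h: "h \<in> borel_measurable (E1 \<Otimes>\<^sub>M E2)"
    and gh: "\<forall>z\<in>space S1 \<times> space S2. g z = h (?T z)" ..
  have suff': "AE z in sum_measure ?P ?Q. gen_deriv ?P ?Q z = h (?T z)"
    using suff AE_space[of "sum_measure ?P ?Q"]
  proof eventually_elim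
    case (elim z)
    then have "z \<in> space S1 \<times> space S2" by (simp add: space_pair_measure)
    from bspec[OF gh this] elim(1) show ?case by (simp only:)
  qed
  have "csiszar_div f (distr ?P (E1 \<Otimes>\<^sub>M E2) ?T) (distr ?Q (E1 \<Otimes>\<^sub>M E2) ?T) = csiszar_div f ?P ?Q"
    by (rule csiszar_div_distr[OF f P.finite_measure_axioms Q.finite_measure_axioms sets T h suff'])
  moreover have "distr ?Q (E1 \<Otimes>\<^sub>M E2) ?T = joint_law M E1 E2 (\<lambda>\<omega>. \<phi>1 (X1 \<omega>)) (\<lambda>\<omega>. \<phi>2 (X2 \<omega>))"
    by (subst distr_distr) (auto simp: o_def)
  moreover have "distr ?P (E1 \<Otimes>\<^sub>M E2) ?T = product_law M E1 E2 (\<lambda>\<omega>. \<phi>1 (X1 \<omega>)) (\<lambda>\<omega>. \<phi>2 (X2 \<omega>))"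
  proof -
    have "prob_space (distr (distr M S2 X2) E2 \<phi>2)"
      by (rule D2.prob_space_distr) measurable
    then have "distr ?P (E1 \<Otimes>\<^sub>M E2) ?T = distr (distr M S1 X1) E1 \<phi>1 \<Otimes>\<^sub>M distr (distr M S2 X2) E2 \<phi>2"
      by (intro pair_measure_distr[symmetric])
         (auto intro: prob_space_imp_sigma_finite)
    then show ?thesis by (simp add: distr_distr o_def)
  qed
  ultimately show ?thesis by (simp add: csiszar_index_def)
qed

text \<open>Here \<open>\<phi>\<^sub>1\<close> and \<open>\<phi>\<^sub>2\<close> generate the given \<open>\<sigma>\<close>-algebras, so the derivative itself is
  the function \<open>g\<close> that marginal invariance asks for.\<close>

lemma csiszar_index_bi_measurable:
  assumes f: "f \<in> borel_measurable borel" and M: "prob_space M"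
    and X: "X1 \<in> M \<rightarrow>\<^sub>M S1" "X2 \<in> M \<rightarrow>\<^sub>M S2"
    and \<phi>: "\<phi>1 \<in> S1 \<rightarrow>\<^sub>M E1" "\<phi>2 \<in> S2 \<rightarrow>\<^sub>M E2"
    and inj: "inj_on \<phi>1 (space S1)" "inj_on \<phi>2 (space S2)"
    and bi: "bi_measurable \<phi>1 S1 E1" "bi_measurable \<phi>2 S2 E2"
  shows "csiszar_index f M S1 S2 X1 X2
    = csiszar_index f M E1 E2 (\<lambda>\<omega>. \<phi>1 (X1 \<omega>)) (\<lambda>\<omega>. \<phi>2 (X2 \<omega>))"
proof (rule csiszar_index_marginal[OF f M X \<phi>])
  let ?P = "product_law M S1 S2 X1 X2" and ?Q = "joint_law M S1 S2 X1 X2"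
  have meas: "gen_deriv ?P ?Q \<in> borel_measurable ?P"
    by (intro measurable_gen_deriv) (simp cong: sets_pair_measure_cong)
  have sets_eq: "sets (vimage_algebra (space S1) \<phi>1 E1 \<Otimes>\<^sub>M vimage_algebra (space S2) \<phi>2 E2) = sets ?P"
    using bi_measurable_sets_eq[OF \<phi>(1) inj(1) bi(1)] bi_measurable_sets_eq[OF \<phi>(2) inj(2) bi(2)]
    by (intro sets_pair_measure_cong) simp_all
  from meas show "gen_deriv ?P ?Q \<in> borel_measurable
      (vimage_algebra (space S1) \<phi>1 E1 \<Otimes>\<^sub>M vimage_algebra (space S2) \<phi>2 E2)"
    unfolding measurable_cong_sets[OF sets_eq refl] .
qed simp

section \<open>Invariance under a common kernel that remembers its argument\<close>

text \<open>The hypothesis \<open>distr (K b) B T = return B b\<close> expresses that \<open>K b\<close> is concentrated on the fibre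
  of \<open>T\<close> over \<open>b\<close>. It is stated by means of the image measure, because the set where \<open>T x = b\<close> need not
  be measurable when \<open>B\<close> does not separate points. It still implies that every measurable function
  of \<open>T\<close> is constant \<open>K b\<close>-almost everywhere.\<close>

lemma nn_integral_bind_fibre:
  assumes P: "P \<in> space (prob_algebra B)" and K[measurable]: "K \<in> B \<rightarrow>\<^sub>M prob_algebra A"
    and T[measurable]: "T \<in> A \<rightarrow>\<^sub>M B"
    and fibre: "\<And>b. b \<in> space B \<Longrightarrow> distr (K b) B T = return B b"
    and g[measurable]: "g \<in> borel_measurable B" and C[measurable]: "C \<in> sets A"
  shows "(\<integral>\<^sup>+ x. g (T x) * indicator C x \<partial>(P \<bind> K)) = (\<integral>\<^sup>+ b. g b * emeasure (K b) C \<partial>P)"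
proof -
  have setsP: "sets P = sets B" using P by (simp add: space_prob_algebra)
  have "K \<in> P \<rightarrow>\<^sub>M subprob_algebra A"
    using measurable_prob_algebraD[OF K] by (simp add: measurable_cong_sets[OF setsP refl])
  then have "(\<integral>\<^sup>+ x. g (T x) * indicator C x \<partial>(P \<bind> K)) = (\<integral>\<^sup>+ b. \<integral>\<^sup>+ x. g (T x) * indicator C x \<partial>K b \<partial>P)"
    by (intro nn_integral_bind[where B=A]) measurable
  also have "\<dots> = (\<integral>\<^sup>+ b. g b * emeasure (K b) C \<partial>P)"
  proof (rule nn_integral_cong)
    fix b assume "b \<in> space P"
    then have b: "b \<in> space B" using sets_eq_imp_space_eq[OF setsP] by simp
    then have sets: "sets (K b) = sets A"
      using measurable_space[OF K] by (simp add: space_prob_algebra)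
    have "AE y in distr (K b) B T. g y = g b"
      unfolding fibre[OF b] by (subst AE_return) (simp_all add: b)
    then have "AE x in K b. g (T x) = g b"
      by (rule AE_distrD[rotated]) (simp add: measurable_cong_sets[OF sets refl])
    then have "(\<integral>\<^sup>+ x. g (T x) * indicator C x \<partial>K b) = (\<integral>\<^sup>+ x. g b * indicator C x \<partial>K b)"
      by (intro nn_integral_cong_AE) auto
    also have "\<dots> = g b * emeasure (K b) C"
      using C by (simp add: nn_integral_cmult_indicator sets)
    finally show "(\<integral>\<^sup>+ x. g (T x) * indicator C x \<partial>K b) = g b * emeasure (K b) C" .
  qed
  finally show ?thesis .
qed

lemma distr_bind_fibre:
  assumes P: "P \<in> space (prob_algebra B)" and K: "K \<in> B \<rightarrow>\<^sub>M prob_algebra A"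
    and T: "T \<in> A \<rightarrow>\<^sub>M B"
    and fibre: "\<And>b. b \<in> space B \<Longrightarrow> distr (K b) B T = return B b"
  shows "distr (P \<bind> K) B T = P"
proof (rule measure_eqI)
  have setsP: "sets P = sets B" using P by (simp add: space_prob_algebra)
  have sets: "sets (P \<bind> K) = sets A" using sets_bind'[OF P K] .
  fix D assume "D \<in> sets (distr (P \<bind> K) B T)"
  then have [measurable]: "D \<in> sets B" by simp
  have "emeasure (distr (P \<bind> K) B T) D = (\<integral>\<^sup>+ y. indicator D y \<partial>distr (P \<bind> K) B T)"
    by simp
  also have "\<dots> = (\<integral>\<^sup>+ x. indicator D (T x) \<partial>(P \<bind> K))"
    using T by (intro nn_integral_distr) (simp_all add: measurable_cong_sets[OF sets refl])
  also have "\<dots> = (\<integral>\<^sup>+ x. indicator D (T x) * indicator (space A) x \<partial>(P \<bind> K))"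
    by (intro nn_integral_cong) (simp add: sets_eq_imp_space_eq[OF sets])
  also have "\<dots> = (\<integral>\<^sup>+ b. indicator D b * emeasure (K b) (space A) \<partial>P)"
    by (rule nn_integral_bind_fibre[OF P K T fibre]) auto
  also have "\<dots> = (\<integral>\<^sup>+ b. indicator D b \<partial>P)"
  proof (rule nn_integral_cong)
    fix b assume "b \<in> space P"
    then have "prob_space (K b)" "sets (K b) = sets A"
      using measurable_space[OF K, of b] sets_eq_imp_space_eq[OF setsP] by (simp_all add: space_prob_algebra)
    then show "indicator D b * emeasure (K b) (space A) = indicator D b"
      using prob_space.emeasure_space_1[of "K b"] sets_eq_imp_space_eq[of "K b" A] by simp
  qed
  finally show "emeasure (distr (P \<bind> K) B T) D = emeasure P D"
    by (simp add: setsP)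
qed (use P in \<open>simp add: space_prob_algebra\<close>)

text \<open>Densities survive a common kernel: if \<open>R\<close> has the density \<open>r\<close> with respect to \<open>P + Q\<close>, then after
  the kernel the density is \<open>r \<circ> T\<close>, because \<open>r \<circ> T\<close> is constant on the fibres. This is used for
  \<open>R = P\<close> and for \<open>R = Q\<close>.\<close>

lemma density_bind_fibre:
  assumes P: "P \<in> space (prob_algebra B)" and Q: "Q \<in> space (prob_algebra B)"
    and K[measurable]: "K \<in> B \<rightarrow>\<^sub>M prob_algebra A" and T[measurable]: "T \<in> A \<rightarrow>\<^sub>M B"
    and fibre: "\<And>b. b \<in> space B \<Longrightarrow> distr (K b) B T = return B b"
    and r[measurable]: "r \<in> borel_measurable B"
    and R: "R \<in> space (prob_algebra B)" "R = density (sum_measure P Q) r"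
  shows "R \<bind> K = density (sum_measure (P \<bind> K) (Q \<bind> K)) (\<lambda>x. r (T x))"
proof (rule measure_eqI)
  note [simp] = sets_bind'[OF P K] sets_bind'[OF Q K] sets_bind'[OF R(1) K]
  have setsP [simp]: "sets P = sets B" "sets Q = sets B" using P Q by (simp_all add: space_prob_algebra)
  show "sets (R \<bind> K) = sets (density (sum_measure (P \<bind> K) (Q \<bind> K)) (\<lambda>x. r (T x)))" by simp
  fix C assume "C \<in> sets (R \<bind> K)"
  then have C[measurable]: "C \<in> sets A" by simp
  have KC[measurable]: "(\<lambda>b. emeasure (K b) C) \<in> borel_measurable B"
    using measurable_prob_algebraD[OF K] by measurable
  have meas: "borel_measurable (P \<bind> K) = (borel_measurable A :: ('b \<Rightarrow> ennreal) set)"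
    "borel_measurable (sum_measure (P \<bind> K) (Q \<bind> K)) = (borel_measurable A :: ('b \<Rightarrow> ennreal) set)"
    "borel_measurable P = (borel_measurable B :: ('a \<Rightarrow> ennreal) set)"
    "borel_measurable (sum_measure P Q) = (borel_measurable B :: ('a \<Rightarrow> ennreal) set)"
    by (intro measurable_cong_sets; simp)+
  have "emeasure (density (sum_measure (P \<bind> K) (Q \<bind> K)) (\<lambda>x. r (T x))) C
      = (\<integral>\<^sup>+ x. r (T x) * indicator C x \<partial>sum_measure (P \<bind> K) (Q \<bind> K))"
    by (rule emeasure_density) (simp_all add: meas)
  also have "\<dots> = (\<integral>\<^sup>+ x. r (T x) * indicator C x \<partial>(P \<bind> K)) + (\<integral>\<^sup>+ x. r (T x) * indicator C x \<partial>(Q \<bind> K))"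
    by (rule nn_integral_sum_measure) (simp_all add: meas)
  also have "\<dots> = (\<integral>\<^sup>+ b. r b * emeasure (K b) C \<partial>P) + (\<integral>\<^sup>+ b. r b * emeasure (K b) C \<partial>Q)"
    using nn_integral_bind_fibre[OF P K T fibre r C] nn_integral_bind_fibre[OF Q K T fibre r C] by simp
  also have "\<dots> = (\<integral>\<^sup>+ b. r b * emeasure (K b) C \<partial>sum_measure P Q)"
    by (rule nn_integral_sum_measure[symmetric]) (simp_all add: meas)
  also have "\<dots> = (\<integral>\<^sup>+ b. emeasure (K b) C \<partial>R)"
    unfolding R(2) by (rule nn_integral_density[symmetric]) (simp_all add: meas)
  also have "\<dots> = emeasure (R \<bind> K) C"
    by (rule emeasure_bind_prob_algebra[OF R(1) K C, symmetric])
  finally show "emeasure (R \<bind> K) C = emeasure (density (sum_measure (P \<bind> K) (Q \<bind> K)) (\<lambda>x. r (T x))) C" ..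
qed

text \<open>By the preceding lemma the ratio of the densities after the kernel is \<open>(p / q) \<circ> T\<close>, so \<open>T\<close> is
  sufficient; and the images under \<open>T\<close> are \<open>P\<close> and \<open>Q\<close>.\<close>

lemma csiszar_div_bind_fibre:
  assumes f: "f \<in> borel_measurable borel"
    and P: "P \<in> space (prob_algebra B)" and Q: "Q \<in> space (prob_algebra B)"
    and K: "K \<in> B \<rightarrow>\<^sub>M prob_algebra A" and T[measurable]: "T \<in> A \<rightarrow>\<^sub>M B"
    and fibre: "\<And>b. b \<in> space B \<Longrightarrow> distr (K b) B T = return B b"
  shows "csiszar_div f (P \<bind> K) (Q \<bind> K) = csiszar_div f P Q"
proof -
  define p where "p = RN_deriv (sum_measure P Q) P"
  define q where "q = RN_deriv (sum_measure P Q) Q"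
  have sets: "sets P = sets B" "sets Q = sets B" using P Q by (simp_all add: space_prob_algebra)
  have setsK: "sets (P \<bind> K) = sets A" "sets (Q \<bind> K) = sets A"
    using sets_bind'[OF P K] sets_bind'[OF Q K] by auto
  have fin: "finite_measure P" "finite_measure Q"
    using P Q by (auto simp: space_prob_algebra prob_space_def)
  have finK: "finite_measure (P \<bind> K)" "finite_measure (Q \<bind> K)"
    using prob_space_bind'[OF P K] prob_space_bind'[OF Q K] by (auto simp: prob_space_def)
  interpret \<mu>: finite_measure "sum_measure P Q"
    using finite_measure_sum_measure[OF fin] sets by simp
  interpret \<mu>K: finite_measure "sum_measure (P \<bind> K) (Q \<bind> K)"
    using finite_measure_sum_measure[OF finK] setsK by simp
  have [measurable]: "p \<in> borel_measurable B" "q \<in> borel_measurable B"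
    using borel_measurable_RN_deriv[of "sum_measure P Q" P] borel_measurable_RN_deriv[of "sum_measure P Q" Q]
    by (simp_all add: p_def q_def measurable_cong_sets[OF sets_sum_measure refl] measurable_cong_sets[OF sets(1) refl])
  have "P = density (sum_measure P Q) p" "Q = density (sum_measure P Q) q"
    unfolding p_def q_def using absolutely_continuous_sum_measure[of Q P] sets
    by (simp_all add: \<mu>.density_RN_deriv)
  from density_bind_fibre[OF P Q K T fibre _ P this(1)] density_bind_fibre[OF P Q K T fibre _ Q this(2)]
  have dens: "P \<bind> K = density (sum_measure (P \<bind> K) (Q \<bind> K)) (\<lambda>x. p (T x))"
      "Q \<bind> K = density (sum_measure (P \<bind> K) (Q \<bind> K)) (\<lambda>x. q (T x))"
    by simp_all
  have "AE x in sum_measure (P \<bind> K) (Q \<bind> K). gen_deriv (P \<bind> K) (Q \<bind> K) x = p (T x) / q (T x)"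
    by (rule gen_deriv_AE_eq[OF \<mu>K.sigma_finite_measure_axioms _ _ dens finK])
       (simp_all add: measurable_cong_sets[OF sets_sum_measure refl] measurable_cong_sets[OF setsK(1) refl])
  then have "csiszar_div f (distr (P \<bind> K) B T) (distr (Q \<bind> K) B T) = csiszar_div f (P \<bind> K) (Q \<bind> K)"
    using setsK
    by (intro csiszar_div_distr[where h="\<lambda>b. p b / q b", OF f finK])
       (simp_all add: measurable_cong_sets[OF setsK(1) refl])
  then show ?thesis
    by (simp add: distr_bind_fibre[OF P K T fibre] distr_bind_fibre[OF Q K T fibre])
qed

section \<open>Independent Markovian kernels\<close>

lemma emeasure_cond_distr:
  assumes M: "prob_space M" and Y[measurable]: "Y \<in> M \<rightarrow>\<^sub>M S"
    and \<kappa>: "is_cond_distr M S T Y W \<kappa>" and A[measurable]: "A \<in> sets (S \<Otimes>\<^sub>M T)"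
  shows "emeasure (joint_law M S T Y W) A = (\<integral>\<^sup>+ y. emeasure (\<kappa> y) (Pair y -` A) \<partial>distr M S Y)"
proof -
  have [measurable]: "\<kappa> \<in> S \<rightarrow>\<^sub>M prob_algebra T"
    and J: "joint_law M S T Y W = distr M S Y \<bind> (\<lambda>y. \<kappa> y \<bind> (\<lambda>w. return (S \<Otimes>\<^sub>M T) (y, w)))"
    using \<kappa> by (simp_all add: is_cond_distr_def)
  have D: "distr M S Y \<in> space (prob_algebra S)"
    using prob_space.prob_space_distr[OF M Y] by (simp add: space_prob_algebra)
  have "emeasure (joint_law M S T Y W) A
      = (\<integral>\<^sup>+ y. emeasure (\<kappa> y \<bind> (\<lambda>w. return (S \<Otimes>\<^sub>M T) (y, w))) A \<partial>distr M S Y)"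
    unfolding J by (rule emeasure_bind_prob_algebra[OF D _ A]) measurable
  also have "\<dots> = (\<integral>\<^sup>+ y. emeasure (\<kappa> y) (Pair y -` A) \<partial>distr M S Y)"
  proof (rule nn_integral_cong)
    fix y assume "y \<in> space (distr M S Y)"
    then have y[measurable]: "y \<in> space S" by simp
    then have \<kappa>y: "\<kappa> y \<in> space (prob_algebra T)"
      using measurable_space[OF \<open>\<kappa> \<in> _\<close>] by simp
    have "emeasure (\<kappa> y \<bind> (\<lambda>w. return (S \<Otimes>\<^sub>M T) (y, w))) A
        = (\<integral>\<^sup>+ w. emeasure (return (S \<Otimes>\<^sub>M T) (y, w)) A \<partial>\<kappa> y)"
      by (rule emeasure_bind_prob_algebra[OF \<kappa>y _ A]) measurable
    also have "\<dots> = (\<integral>\<^sup>+ w. indicator (Pair y -` A) w \<partial>\<kappa> y)"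
      by (simp add: indicator_def)
    also have "\<dots> = emeasure (\<kappa> y) (Pair y -` A)"
      using \<kappa>y sets_Pair1[OF A, of y] by (intro nn_integral_indicator) (simp add: space_prob_algebra)
    finally show "emeasure (\<kappa> y \<bind> (\<lambda>w. return (S \<Otimes>\<^sub>M T) (y, w))) A = emeasure (\<kappa> y) (Pair y -` A)" .
  qed
  finally show ?thesis .
qed

text \<open>Both laws of \<open>((Y\<^sub>1, W\<^sub>1), (Y\<^sub>2, W\<^sub>2))\<close> are obtained from those of \<open>(Y\<^sub>1, Y\<^sub>2)\<close> by the
  kernel \<open>K\<close> below. The hypothesis on \<open>\<kappa>\<close> holds almost everywhere for the joint law of \<open>(Y\<^sub>1, Y\<^sub>2)\<close>
  only; this suffices, because the product law involves just \<open>\<kappa>\<^sub>1\<close> and \<open>\<kappa>\<^sub>2\<close>.\<close>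

lemma csiszar_index_independent_kernels:
  assumes f: "f \<in> borel_measurable borel" and M: "prob_space M"
    and Y[measurable]: "Y1 \<in> M \<rightarrow>\<^sub>M S1" "Y2 \<in> M \<rightarrow>\<^sub>M S2"
    and W[measurable]: "W1 \<in> M \<rightarrow>\<^sub>M T1" "W2 \<in> M \<rightarrow>\<^sub>M T2"
    and \<kappa>1: "is_cond_distr M S1 T1 Y1 W1 \<kappa>1" and \<kappa>2: "is_cond_distr M S2 T2 Y2 W2 \<kappa>2"
    and \<kappa>: "is_cond_distr M (S1 \<Otimes>\<^sub>M S2) (T1 \<Otimes>\<^sub>M T2) (\<lambda>\<omega>. (Y1 \<omega>, Y2 \<omega>)) (\<lambda>\<omega>. (W1 \<omega>, W2 \<omega>)) \<kappa>"
    and indep: "AE y in joint_law M S1 S2 Y1 Y2. \<kappa> y = \<kappa>1 (fst y) \<Otimes>\<^sub>M \<kappa>2 (snd y)"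
  shows "csiszar_index f M (S1 \<Otimes>\<^sub>M T1) (S2 \<Otimes>\<^sub>M T2) (\<lambda>\<omega>. (Y1 \<omega>, W1 \<omega>)) (\<lambda>\<omega>. (Y2 \<omega>, W2 \<omega>))
    = csiszar_index f M S1 S2 Y1 Y2"
proof -
  interpret M: prob_space M by fact
  let ?Z = "(S1 \<Otimes>\<^sub>M T1) \<Otimes>\<^sub>M (S2 \<Otimes>\<^sub>M T2)"
  define K where "K y = distr (\<kappa>1 (fst y) \<Otimes>\<^sub>M \<kappa>2 (snd y)) ?Z
    (\<lambda>w. ((fst y, fst w), (snd y, snd w)))" for y
  have k[measurable]: "\<kappa>1 \<in> S1 \<rightarrow>\<^sub>M prob_algebra T1" "\<kappa>2 \<in> S2 \<rightarrow>\<^sub>M prob_algebra T2"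
    using \<kappa>1 \<kappa>2 by (simp_all add: is_cond_distr_def)
  have K: "K \<in> S1 \<Otimes>\<^sub>M S2 \<rightarrow>\<^sub>M prob_algebra ?Z"
    unfolding K_def
    by (intro measurable_distr_prob_space2[where M="T1 \<Otimes>\<^sub>M T2"] measurable_pair_prob) measurable
  have kP: "prob_space (\<kappa>1 y1)" "sets (\<kappa>1 y1) = sets T1" "space (\<kappa>1 y1) = space T1" if "y1 \<in> space S1" for y1
    using measurable_space[OF k(1) that] by (auto simp: space_prob_algebra dest: sets_eq_imp_space_eq)
  have kQ: "prob_space (\<kappa>2 y2)" "sets (\<kappa>2 y2) = sets T2" "space (\<kappa>2 y2) = space T2" if "y2 \<in> space S2" for y2
    using measurable_space[OF k(2) that] by (auto simp: space_prob_algebra dest: sets_eq_imp_space_eq)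
  have mK: "(\<lambda>w. ((fst y, fst w), (snd y, snd w))) \<in> \<kappa>1 (fst y) \<Otimes>\<^sub>M \<kappa>2 (snd y) \<rightarrow>\<^sub>M ?Z"
    if "y \<in> space (S1 \<Otimes>\<^sub>M S2)" for y
  proof -
    have y: "fst y \<in> space S1" "snd y \<in> space S2" using that by (auto simp: space_pair_measure)
    have "(\<lambda>w. ((fst y, fst w), (snd y, snd w))) \<in> T1 \<Otimes>\<^sub>M T2 \<rightarrow>\<^sub>M ?Z"
      using y by measurable
    then show ?thesis
      using kP(2)[OF y(1)] kQ(2)[OF y(2)] by (simp cong: measurable_cong_sets sets_pair_measure_cong)
  qed
  interpret D1: prob_space "distr M S1 Y1" by (rule M.prob_space_distr) fact
  interpret D2: prob_space "distr M S2 Y2" by (rule M.prob_space_distr) fact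
  interpret P: pair_prob_space "distr M S1 Y1" "distr M S2 Y2" ..
  have P: "product_law M S1 S2 Y1 Y2 \<in> space (prob_algebra (S1 \<Otimes>\<^sub>M S2))"
    using P.prob_space_axioms by (simp add: space_prob_algebra cong: sets_pair_measure_cong)
  have Q: "joint_law M S1 S2 Y1 Y2 \<in> space (prob_algebra (S1 \<Otimes>\<^sub>M S2))"
    by (auto simp: space_prob_algebra intro!: M.prob_space_distr)
  have joint: "joint_law M (S1 \<Otimes>\<^sub>M T1) (S2 \<Otimes>\<^sub>M T2) (\<lambda>\<omega>. (Y1 \<omega>, W1 \<omega>)) (\<lambda>\<omega>. (Y2 \<omega>, W2 \<omega>))
      = joint_law M S1 S2 Y1 Y2 \<bind> K" (is "?L = ?R")
  proof (rule measure_eqI)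
    show "sets ?L = sets ?R" using sets_bind'[OF Q K] by simp
    fix A assume "A \<in> sets ?L"
    then have A[measurable]: "A \<in> sets ?Z" by simp
    \<comment> \<open>The conditional law of \<open>(W\<^sub>1, W\<^sub>2)\<close> concerns the grouping \<open>((y\<^sub>1, y\<^sub>2), (w\<^sub>1, w\<^sub>2))\<close> of the
      coordinates, which \<open>swap\<close> turns into the one needed here.\<close>
    define swap where "swap = (\<lambda>(y, w). ((fst y, fst w), (snd y, snd w)) :: ('b \<times> 'd) \<times> ('c \<times> 'e))"
    have [measurable]: "swap \<in> (S1 \<Otimes>\<^sub>M S2) \<Otimes>\<^sub>M (T1 \<Otimes>\<^sub>M T2) \<rightarrow>\<^sub>M ?Z"
      unfolding swap_def by measurable
    let ?J = "joint_law M (S1 \<Otimes>\<^sub>M S2) (T1 \<Otimes>\<^sub>M T2) (\<lambda>\<omega>. (Y1 \<omega>, Y2 \<omega>)) (\<lambda>\<omega>. (W1 \<omega>, W2 \<omega>))"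
    let ?A = "swap -` A \<inter> space ((S1 \<Otimes>\<^sub>M S2) \<Otimes>\<^sub>M (T1 \<Otimes>\<^sub>M T2))"
    have "?L = distr ?J ?Z swap"
      by (subst distr_distr) (auto simp: o_def swap_def)
    then have "emeasure ?L A = emeasure ?J ?A"
      by (simp add: emeasure_distr)
    also have "\<dots> = (\<integral>\<^sup>+ y. emeasure (\<kappa> y) (Pair y -` ?A) \<partial>joint_law M S1 S2 Y1 Y2)"
      by (rule emeasure_cond_distr[OF M _ \<kappa>]) measurable
    also have "\<dots> = (\<integral>\<^sup>+ y. emeasure (K y) A \<partial>joint_law M S1 S2 Y1 Y2)"
    proof (rule nn_integral_cong_AE)
      show "AE y in joint_law M S1 S2 Y1 Y2. emeasure (\<kappa> y) (Pair y -` ?A) = emeasure (K y) A"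
        using indep AE_space
      proof eventually_elim
        case (elim y)
        then have y: "y \<in> space (S1 \<Otimes>\<^sub>M S2)" "fst y \<in> space S1" "snd y \<in> space S2"
          by (auto simp: space_pair_measure)
        have "emeasure (K y) A = emeasure (\<kappa> y)
           ((\<lambda>w. ((fst y, fst w), (snd y, snd w))) -` A \<inter> space (\<kappa> y))"
          unfolding K_def elim(1) using mK[OF y(1)] A by (rule emeasure_distr)
        also have "(\<lambda>w. ((fst y, fst w), (snd y, snd w))) -` A \<inter> space (\<kappa> y) = Pair y -` ?A"
          using y kP(3)[OF y(2)] kQ(3)[OF y(3)]
          by (auto simp: elim(1) swap_def space_pair_measure)
        finally show ?case ..
      qed
    qed
    also have "\<dots> = emeasure ?R A"
      by (rule emeasure_bind_prob_algebra[OF Q K A, symmetric])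
    finally show "emeasure ?L A = emeasure ?R A" .
  qed
  have product: "product_law M (S1 \<Otimes>\<^sub>M T1) (S2 \<Otimes>\<^sub>M T2) (\<lambda>\<omega>. (Y1 \<omega>, W1 \<omega>)) (\<lambda>\<omega>. (Y2 \<omega>, W2 \<omega>))
      = product_law M S1 S2 Y1 Y2 \<bind> K" (is "?N1 \<Otimes>\<^sub>M ?N2 = ?R")
  \<comment> \<open>On rectangles the measure of the kernel is a product of a function of \<open>y\<^sub>1\<close> and one of \<open>y\<^sub>2\<close>.\<close>
  proof (rule pair_measure_eqI)
    show "sigma_finite_measure ?N1" "sigma_finite_measure ?N2"
      by (auto intro!: prob_space_imp_sigma_finite M.prob_space_distr)
    show "sets (?N1 \<Otimes>\<^sub>M ?N2) = sets ?R"
      using sets_bind'[OF P K] by (simp cong: sets_pair_measure_cong)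
    fix A B assume "A \<in> sets ?N1" "B \<in> sets ?N2"
    then have A[measurable]: "A \<in> sets (S1 \<Otimes>\<^sub>M T1)" and B[measurable]: "B \<in> sets (S2 \<Otimes>\<^sub>M T2)" by simp_all
    have AB: "A \<times> B \<in> sets ?Z" by measurable
    let ?a = "\<lambda>y. emeasure (\<kappa>1 y) (Pair y -` A)" and ?b = "\<lambda>y. emeasure (\<kappa>2 y) (Pair y -` B)"
    have K_Times: "emeasure (K y) (A \<times> B) = ?a (fst y) * ?b (snd y)" if y: "y \<in> space (S1 \<Otimes>\<^sub>M S2)" for y
    proof -
      have y': "fst y \<in> space S1" "snd y \<in> space S2" using y by (auto simp: space_pair_measure)
      interpret k2: prob_space "\<kappa>2 (snd y)" using kQ y' by simp
      have "emeasure (K y) (A \<times> B) = emeasure (\<kappa>1 (fst y) \<Otimes>\<^sub>M \<kappa>2 (snd y))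
          ((\<lambda>w. ((fst y, fst w), (snd y, snd w))) -` (A \<times> B) \<inter> space (\<kappa>1 (fst y) \<Otimes>\<^sub>M \<kappa>2 (snd y)))"
        unfolding K_def using mK[OF y] AB by (rule emeasure_distr)
      also have "(\<lambda>w. ((fst y, fst w), (snd y, snd w))) -` (A \<times> B) \<inter> space (\<kappa>1 (fst y) \<Otimes>\<^sub>M \<kappa>2 (snd y))
          = (Pair (fst y) -` A) \<times> (Pair (snd y) -` B)"
        using sets.sets_into_space[OF A] sets.sets_into_space[OF B] kP(3)[OF y'(1)] kQ(3)[OF y'(2)]
        by (auto simp: space_pair_measure)
      also have "emeasure (\<kappa>1 (fst y) \<Otimes>\<^sub>M \<kappa>2 (snd y)) \<dots> = ?a (fst y) * ?b (snd y)"
        using sets_Pair1[OF A] sets_Pair1[OF B] kP(2)[OF y'(1)] kQ(2)[OF y'(2)]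
        by (intro k2.emeasure_pair_measure_Times) auto
      finally show ?thesis .
    qed
    have "(\<lambda>y. emeasure (K y) (A \<times> B)) \<in> borel_measurable (S1 \<Otimes>\<^sub>M S2)"
      using measurable_prob_algebraD[OF K] AB by measurable
    then have KAB: "(\<lambda>y. emeasure (K y) (A \<times> B)) \<in> borel_measurable (product_law M S1 S2 Y1 Y2)"
      by (simp cong: measurable_cong_sets sets_pair_measure_cong)
    have ab: "?a \<in> borel_measurable S1" "?b \<in> borel_measurable S2"
    proof -
      have "(SIGMA y:space S1. Pair y -` A) = A" "(SIGMA y:space S2. Pair y -` B) = B"
        using sets.sets_into_space[OF A] sets.sets_into_space[OF B] by (auto simp: space_pair_measure)
      then show "?a \<in> borel_measurable S1" "?b \<in> borel_measurable S2"
        using A B k[THEN measurable_prob_algebraD]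
        by (auto intro!: emeasure_measurable_subprob_algebra2)
    qed
    have "emeasure ?R (A \<times> B) = (\<integral>\<^sup>+ y. emeasure (K y) (A \<times> B) \<partial>product_law M S1 S2 Y1 Y2)"
      by (rule emeasure_bind_prob_algebra[OF P K AB])
    also have "\<dots> = (\<integral>\<^sup>+ y1. \<integral>\<^sup>+ y2. emeasure (K (y1, y2)) (A \<times> B) \<partial>distr M S2 Y2 \<partial>distr M S1 Y1)"
      by (rule D2.nn_integral_fst[OF KAB, symmetric])
    also have "\<dots> = (\<integral>\<^sup>+ y1. \<integral>\<^sup>+ y2. ?a y1 * ?b y2 \<partial>distr M S2 Y2 \<partial>distr M S1 Y1)"
      by (intro nn_integral_cong) (simp add: K_Times space_pair_measure)
    also have "\<dots> = (\<integral>\<^sup>+ y1. ?a y1 \<partial>distr M S1 Y1) * (\<integral>\<^sup>+ y2. ?b y2 \<partial>distr M S2 Y2)"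
      using ab by (simp add: nn_integral_cmult nn_integral_multc)
    also have "\<dots> = emeasure ?N1 A * emeasure ?N2 B"
      using emeasure_cond_distr[OF M Y(1) \<kappa>1 A] emeasure_cond_distr[OF M Y(2) \<kappa>2 B] by simp
    finally show "emeasure ?N1 A * emeasure ?N2 B = emeasure ?R (A \<times> B)" ..
  qed
  let ?T = "\<lambda>x. (fst (fst x), fst (snd x))"
  have T: "?T \<in> ?Z \<rightarrow>\<^sub>M S1 \<Otimes>\<^sub>M S2" by measurable
  have fibre: "distr (K y) (S1 \<Otimes>\<^sub>M S2) ?T = return (S1 \<Otimes>\<^sub>M S2) y" if y: "y \<in> space (S1 \<Otimes>\<^sub>M S2)" for y
  proof -
    have "fst y \<in> space S1" "snd y \<in> space S2" using y by (auto simp: space_pair_measure)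
    then have "prob_space (\<kappa>1 (fst y) \<Otimes>\<^sub>M \<kappa>2 (snd y))"
      using kP(1) kQ(1) by (intro prob_space_pair)
    then show ?thesis
      using y unfolding K_def
      by (simp add: distr_distr[OF T mK[OF y]] o_def prob_space.distr_const)
  qed
  show ?thesis
    unfolding csiszar_index_def joint product
    by (rule csiszar_div_bind_fibre[OF f P Q K T fibre])
qed

section \<open>The three invariance properties\<close>

theorem proposition9:
  fixes f :: "real \<Rightarrow> ereal"
    and M :: "'w measure"
    and \<Omega>1 :: "'a1 measure" and \<Omega>2 :: "'a2 measure"
    and E1 :: "'e1 measure" and E2 :: "'e2 measure"
    and X1 :: "'w \<Rightarrow> 'a1" and X2 :: "'w \<Rightarrow> 'a2"
    and \<phi>1 :: "'a1 \<Rightarrow> 'e1" and \<phi>2 :: "'a2 \<Rightarrow> 'e2"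
  assumes "f \<in> csiszar_class"
    and "prob_space M"
    and "X1 \<in> M \<rightarrow>\<^sub>M \<Omega>1" and "X2 \<in> M \<rightarrow>\<^sub>M \<Omega>2"
    and "\<phi>1 \<in> \<Omega>1 \<rightarrow>\<^sub>M E1" and "\<phi>2 \<in> \<Omega>2 \<rightarrow>\<^sub>M E2"
  shows
    "((\<exists>g \<in> borel_measurable
              (vimage_algebra (space \<Omega>1) \<phi>1 E1 \<Otimes>\<^sub>M vimage_algebra (space \<Omega>2) \<phi>2 E2).
         AE z in sum_measure (product_law M \<Omega>1 \<Omega>2 X1 X2) (joint_law M \<Omega>1 \<Omega>2 X1 X2).
           g z = gen_deriv (product_law M \<Omega>1 \<Omega>2 X1 X2) (joint_law M \<Omega>1 \<Omega>2 X1 X2) z) \<longrightarrow>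
      csiszar_index f M \<Omega>1 \<Omega>2 X1 X2
        = csiszar_index f M E1 E2 (\<lambda>\<omega>. \<phi>1 (X1 \<omega>)) (\<lambda>\<omega>. \<phi>2 (X2 \<omega>)))
    \<and>
     (inj_on \<phi>1 (space \<Omega>1) \<and> bi_measurable \<phi>1 \<Omega>1 E1 \<and>
      inj_on \<phi>2 (space \<Omega>2) \<and> bi_measurable \<phi>2 \<Omega>2 E2 \<longrightarrow>
      csiszar_index f M \<Omega>1 \<Omega>2 X1 X2
        = csiszar_index f M E1 E2 (\<lambda>\<omega>. \<phi>1 (X1 \<omega>)) (\<lambda>\<omega>. \<phi>2 (X2 \<omega>)))
    \<and>
     (\<forall>(Y1 :: 'w \<Rightarrow> 'y1::polish_space) (W1 :: 'w \<Rightarrow> 'w1::polish_space)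
        (Y2 :: 'w \<Rightarrow> 'y2::polish_space) (W2 :: 'w \<Rightarrow> 'w2::polish_space) \<kappa>1 \<kappa>2 \<kappa>.
        Y1 \<in> borel_measurable M \<and> W1 \<in> borel_measurable M \<and>
        Y2 \<in> borel_measurable M \<and> W2 \<in> borel_measurable M \<and>
        is_cond_distr M borel borel Y1 W1 \<kappa>1 \<and>
        is_cond_distr M borel borel Y2 W2 \<kappa>2 \<and>
        is_cond_distr M (borel \<Otimes>\<^sub>M borel) (borel \<Otimes>\<^sub>M borel)
          (\<lambda>\<omega>. (Y1 \<omega>, Y2 \<omega>)) (\<lambda>\<omega>. (W1 \<omega>, W2 \<omega>)) \<kappa> \<and>
        (AE (y1, y2) in joint_law M borel borel Y1 Y2. \<kappa> (y1, y2) = \<kappa>1 y1 \<Otimes>\<^sub>M \<kappa>2 y2) \<longrightarrow>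
        csiszar_index f M (borel \<Otimes>\<^sub>M borel) (borel \<Otimes>\<^sub>M borel)
            (\<lambda>\<omega>. (Y1 \<omega>, W1 \<omega>)) (\<lambda>\<omega>. (Y2 \<omega>, W2 \<omega>))
          = csiszar_index f M borel borel Y1 Y2)"
proof (intro conjI impI allI; (elim conjE)?)
  have f: "f \<in> borel_measurable borel"
    using assms(1) proper_convex_borel_measurable by (simp add: csiszar_class_def)
  show "csiszar_index f M \<Omega>1 \<Omega>2 X1 X2
      = csiszar_index f M E1 E2 (\<lambda>\<omega>. \<phi>1 (X1 \<omega>)) (\<lambda>\<omega>. \<phi>2 (X2 \<omega>))"
    if "\<exists>g \<in> borel_measurable
              (vimage_algebra (space \<Omega>1) \<phi>1 E1 \<Otimes>\<^sub>M vimage_algebra (space \<Omega>2) \<phi>2 E2).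
         AE z in sum_measure (product_law M \<Omega>1 \<Omega>2 X1 X2) (joint_law M \<Omega>1 \<Omega>2 X1 X2).
           g z = gen_deriv (product_law M \<Omega>1 \<Omega>2 X1 X2) (joint_law M \<Omega>1 \<Omega>2 X1 X2) z"
    using that csiszar_index_marginal[OF f assms(2-6)] by blast
  show "csiszar_index f M \<Omega>1 \<Omega>2 X1 X2
      = csiszar_index f M E1 E2 (\<lambda>\<omega>. \<phi>1 (X1 \<omega>)) (\<lambda>\<omega>. \<phi>2 (X2 \<omega>))"
    if "inj_on \<phi>1 (space \<Omega>1)" "bi_measurable \<phi>1 \<Omega>1 E1" "inj_on \<phi>2 (space \<Omega>2)" "bi_measurable \<phi>2 \<Omega>2 E2"
    using that by (intro csiszar_index_bi_measurable[OF f assms(2-6)])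
  fix Y1 :: "'w \<Rightarrow> 'y1::polish_space" and W1 :: "'w \<Rightarrow> 'w1::polish_space"
    and Y2 :: "'w \<Rightarrow> 'y2::polish_space" and W2 :: "'w \<Rightarrow> 'w2::polish_space" and \<kappa>1 \<kappa>2 \<kappa>
  assume Y: "Y1 \<in> borel_measurable M" "Y2 \<in> borel_measurable M"
    and W: "W1 \<in> borel_measurable M" "W2 \<in> borel_measurable M"
    and \<kappa>: "is_cond_distr M borel borel Y1 W1 \<kappa>1" "is_cond_distr M borel borel Y2 W2 \<kappa>2"
      "is_cond_distr M (borel \<Otimes>\<^sub>M borel) (borel \<Otimes>\<^sub>M borel)
          (\<lambda>\<omega>. (Y1 \<omega>, Y2 \<omega>)) (\<lambda>\<omega>. (W1 \<omega>, W2 \<omega>)) \<kappa>"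
    and indep: "AE (y1, y2) in joint_law M borel borel Y1 Y2. \<kappa> (y1, y2) = \<kappa>1 y1 \<Otimes>\<^sub>M \<kappa>2 y2"
  from indep have "AE y in joint_law M borel borel Y1 Y2. \<kappa> y = \<kappa>1 (fst y) \<Otimes>\<^sub>M \<kappa>2 (snd y)"
    by (rule AE_mp) (auto intro!: AE_I2)
  then show "csiszar_index f M (borel \<Otimes>\<^sub>M borel) (borel \<Otimes>\<^sub>M borel)
            (\<lambda>\<omega>. (Y1 \<omega>, W1 \<omega>)) (\<lambda>\<omega>. (Y2 \<omega>, W2 \<omega>))
          = csiszar_index f M borel borel Y1 Y2"
    by (rule csiszar_index_independent_kernels[OF f assms(2) Y W \<kappa>])
qed

end
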